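(* Let $\Omega\subseteq\mathbb{R}^2$ and let $u:\Omega\to\mathbb{R}^N$ be an $\infty$-Harmonic map in $C^2(\Omega)^N$. Then either $|Du|>0$ on $\Omega$ or $|Du|\equiv0$ on $\Omega$. Hence, non-constant $\infty$-Harmonic maps have positive rank.
   Context: $\Omega$ is an open subset of $\mathbb{R}^2$. For $u=(u_1,\dots,u_N):\Omega\subseteq\mathbb{R}^n\to\mathbb{R}^N$ the gradient $Du=(D_iu_\alpha)$ is viewed as an $N\times n$ matrix, with Euclidean norm $|Du|=(D_iu_\alpha D_iu_\alpha)^{1/2}$ (summation over repeated indices; Greek indices from $1$ to $N$, Latin from $1$ to $n$). $[Du]^\perp$ is the orthogonal projection of $\mathbb{R}^N$ onto the nullspace of $(Du)^\top:\mathbb{R}^N\to\mathbb{R}^n$. An $\infty$-Harmonic map is a $C^2$ solution of the $\infty$-Laplacian system $\Delta_\infty u=0$, i.e. $$D_iu_\alpha\,D_ju_\beta\,D^2_{ij}u_\beta+|Du|^2[Du]^\perp_{\alpha\beta}D^2_{ii}u_\beta=0,\qquad \alpha=1,\dots,N.$$ The rank of the map refers to $\mathrm{rk}(Du)$.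
   Formalization: Ω is additionally assumed connected; for a merely open Ω the claim fails (two disjoint balls, u = 0 on one and u = (x₁,0,…,0) on the other), and for such Ω the result applies on each connected component. *)

theory Defs
  imports "HOL-Analysis.Analysis"
begin

text \<open>
  A map \<open>u\<close> on an open \<open>\<Omega>\<close> is a total function of which only the values on \<open>\<Omega>\<close> matter.
  The entry \<open>Du u x $ \<alpha> $ i\<close> is \<open>D\<^sub>i u\<^sub>\<alpha>(x)\<close>, and \<open>norm\<close> on the matrix type is the
  Euclidean (Frobenius) norm.
\<close>

abbreviation Du :: "(real^'n \<Rightarrow> real^'N) \<Rightarrow> real^'n \<Rightarrow> real^'n^'N" where
  "Du u x \<equiv> jacobian u (at x)"

definition D2 :: "(real^'n \<Rightarrow> real^'N) \<Rightarrow> real^'n \<Rightarrow> 'N \<Rightarrow> real^'n^'n" where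
  \<comment> \<open>\<open>D2 u x \<beta> $ j $ i\<close> is \<open>D\<^sub>i (D\<^sub>j u\<^sub>\<beta>)(x)\<close>\<close>
  "D2 u x \<beta> = jacobian (\<lambda>y. Du u y $ \<beta>) (at x)"

definition C2_on :: "(real^'n) set \<Rightarrow> (real^'n \<Rightarrow> real^'N) \<Rightarrow> bool" where
  "C2_on \<Omega> u \<longleftrightarrow>
     (\<forall>x\<in>\<Omega>. u differentiable (at x)) \<and>
     (\<forall>\<beta>. \<forall>x\<in>\<Omega>. (\<lambda>y. Du u y $ \<beta>) differentiable (at x)) \<and>
     (\<forall>\<beta>. continuous_on \<Omega> (\<lambda>x. D2 u x \<beta>))"

definition orth_proj :: "'a::euclidean_space set \<Rightarrow> 'a \<Rightarrow> 'a" where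
  "orth_proj S v = (THE p. p \<in> S \<and> (\<forall>s\<in>S. orthogonal (v - p) s))"

lemma orth_proj_ex1:
  fixes S :: "'a::euclidean_space set"
  assumes "subspace S"
  shows "\<exists>!p. p \<in> S \<and> (\<forall>s\<in>S. orthogonal (v - p) s)"
proof -
  have S: "span S = S"
    using assms by (simp add: span_eq_iff)
  obtain y z where "y \<in> span S" "\<And>w. w \<in> span S \<Longrightarrow> orthogonal z w" "v = y + z"
    using orthogonal_subspace_decomp_exists [of S v] by blast
  then have y: "y \<in> S \<and> (\<forall>s\<in>S. orthogonal (v - y) s)"
    by (simp add: S)
  show ?thesis
  proof (rule ex1I [where a = y], rule y)
    fix p assume p: "p \<in> S \<and> (\<forall>s\<in>S. orthogonal (v - p) s)"
    then have "p - y \<in> S"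
      using y assms by (simp add: subspace_diff)
    then have "(v - y) \<bullet> (p - y) = 0" "(v - p) \<bullet> (p - y) = 0"
      using p y by (auto simp: orthogonal_def)
    then have "(p - y) \<bullet> (p - y) = 0"
      by (simp add: inner_diff_left)
    then show "p = y"
      by simp
  qed
qed

definition Du_perp :: "(real^'n \<Rightarrow> real^'N) \<Rightarrow> real^'n \<Rightarrow> real^'N^'N" where
  "Du_perp u x = matrix (orth_proj {\<xi>. transpose (Du u x) *v \<xi> = 0})"

definition infinity_harmonic_on :: "(real^'n) set \<Rightarrow> (real^'n \<Rightarrow> real^'N) \<Rightarrow> bool" where
  "infinity_harmonic_on \<Omega> u \<longleftrightarrow>
     C2_on \<Omega> u \<and>
     (\<forall>x\<in>\<Omega>. \<forall>\<alpha>.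
        (\<Sum>i\<in>UNIV. \<Sum>j\<in>UNIV. \<Sum>\<beta>\<in>UNIV.
            Du u x $ \<alpha> $ i * Du u x $ \<beta> $ j * D2 u x \<beta> $ j $ i)
        + (norm (Du u x))\<^sup>2 *
          (\<Sum>\<beta>\<in>UNIV. \<Sum>i\<in>UNIV. Du_perp u x $ \<alpha> $ \<beta> * D2 u x \<beta> $ i $ i) = 0)"

end

theory Submission
  imports Defs
begin

text \<open>
  Put \<open>v = |Du|\<^sup>2\<close>. The component of the system in the range of \<open>Du\<close> says \<open>Du (\<nabla>v) = 0\<close>. Compare \<open>v\<close> with the barrier
  \<open>c (|x - x0|\<^sup>-\<^sup>2 - R\<^sup>-\<^sup>2)\<close> on an annulus around a point \<open>x0\<close> with \<open>v x0 > 0\<close>. At a negative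
  interior minimum \<open>y\<close> of the difference, \<open>\<nabla>v\<close> is a nonzero multiple of \<open>d = y - x0\<close>, so in the
  plane \<open>Du y\<close> has rank one, \<open>Du y = \<xi> \<otimes> d\<^sup>\<bottom>\<close>. The function \<open>v\<close> is constant along the flow of
  \<open>\<nabla>(\<xi> \<bullet> u)\<close>, whereas the flow line through \<open>y\<close> is tangent to the circle around \<open>x0\<close> and curves
  so strongly towards \<open>x0\<close> that the barrier increases along it to second order, a contradiction.
  Hence \<open>v\<close> is positive on every ball in \<open>\<Omega>\<close> with centre in \<open>{v > 0}\<close>, and this set is open
  and closed in \<open>\<Omega>\<close>.
\<close>

section \<open>Second-order calculus in inner product spaces\<close>

text \<open>The mean value theorem in direction \<open>a\<close> turns the second difference into
  \<open>t\<close> times an increment of \<open>G\<close> between two points that differ by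
  \<open>t *\<^sub>R b\<close>. Both values of \<open>G\<close> are compared with the linearisation
  at \<open>x\<close>, which leaves an error o(t).\<close>

lemma second_difference_tendsto:
  fixes f :: "'a::real_inner \<Rightarrow> real" and G :: "'a \<Rightarrow> 'a"
  assumes "open S" "x \<in> S"
    and f: "\<And>y. y \<in> S \<Longrightarrow> (f has_derivative (\<lambda>h. G y \<bullet> h)) (at y)"
    and G: "(G has_derivative D) (at x)"
  shows "((\<lambda>t. (f (x + t *\<^sub>R a + t *\<^sub>R b) - f (x + t *\<^sub>R a) - f (x + t *\<^sub>R b) + f x) / t\<^sup>2)
            \<longlongrightarrow> a \<bullet> D b) (at_right 0)"
proof (rule tendstoI)
  fix e :: real assume "e > 0"
  define N where "N = norm a + norm b + 1"
  have N: "N > 0" "norm a \<le> N" "norm b \<le> N" "norm a + norm b \<le> N"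
    by (auto simp: N_def add_nonneg_pos)
  \<comment> \<open>Chosen so that the final error 2 * \<open>e'\<close> * N * N equals e /
    2.\<close>
  define e' where "e' = e / (4 * N * N)"
  have e': "e' > 0" using \<open>e > 0\<close> N by (simp add: e'_def)
  interpret D: bounded_linear D using G by (rule has_derivative_bounded_linear)
  obtain r where r: "r > 0" "ball x r \<subseteq> S"
    using assms(1,2) openE by blast
  obtain d where d: "d > 0" "\<And>y. norm (y - x) < d \<Longrightarrow> norm (G y - G x - D (y - x)) \<le> e' * norm (y - x)"
    using G e' unfolding has_derivative_at_alt by blast
  define \<delta> where "\<delta> = min r d / N"
  have "\<delta> > 0" using r d N by (simp add: \<delta>_def)
  have "dist ((f (x + t *\<^sub>R a + t *\<^sub>R b) - f (x + t *\<^sub>R a) - f (x + t *\<^sub>R b) + f x) / t\<^sup>2) (a \<bullet> D b) < e"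
    if t: "0 < t" "t < \<delta>" for t
  proof -
    have tN: "t * N < r" "t * N < d"
      using t N by (auto simp: \<delta>_def pos_less_divide_eq)
    have nb: "norm (s *\<^sub>R a + s' *\<^sub>R b) \<le> t * N" if "0 \<le> s" "s \<le> t" "0 \<le> s'" "s' \<le> t" for s s'
    proof -
      have "norm (s *\<^sub>R a + s' *\<^sub>R b) \<le> s * norm a + s' * norm b"
        using norm_triangle_ineq[of "s *\<^sub>R a" "s' *\<^sub>R b"] that by simp
      also have "\<dots> \<le> t * norm a + t * norm b"
        using that by (intro add_mono mult_right_mono) auto
      also have "\<dots> \<le> t * N"
        using N t by (simp flip: distrib_left)
      finally show ?thesis .
    qed
    have inS: "x + s *\<^sub>R a + s' *\<^sub>R b \<in> S" if "0 \<le> s" "s \<le> t" "0 \<le> s'" "s' \<le> t" for s s'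
    proof -
      have "dist x (x + s *\<^sub>R a + s' *\<^sub>R b) < r"
        using nb[OF that] tN by (simp add: dist_norm norm_minus_commute algebra_simps)
      then show ?thesis using r by auto
    qed
    \<comment> \<open>The term \<open>0 *\<^sub>R b\<close> is kept so that both summands are
      instances of one family, with coefficient \<open>t\<close> or 0 on \<open>b\<close>, and share
      the derivative computed next.\<close>
    define \<phi> where "\<phi> = (\<lambda>s. f (x + s *\<^sub>R a + t *\<^sub>R b) - f (x + s *\<^sub>R a + 0 *\<^sub>R b))"
    have der: "(\<phi> has_derivative (\<lambda>h. h * ((G (x + s *\<^sub>R a + t *\<^sub>R b) - G (x + s *\<^sub>R a + 0 *\<^sub>R b)) \<bullet> a)))
        (at s within {0..t})" if "0 \<le> s" "s \<le> t" for s
    proof -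
      have "((\<lambda>s. f (x + s *\<^sub>R a + c *\<^sub>R b)) has_derivative (\<lambda>h. G (x + s *\<^sub>R a + c *\<^sub>R b) \<bullet> (h *\<^sub>R a))) (at s within {0..t})"
        if "c \<in> {0..t}" for c
      proof -
        have "((\<lambda>s. x + s *\<^sub>R a + c *\<^sub>R b) has_derivative (\<lambda>h. h *\<^sub>R a)) (at s within {0..t})"
          by (auto intro!: derivative_eq_intros)
        from has_derivative_compose[OF this f[OF inS]] show ?thesis
          using that \<open>0 \<le> s\<close> \<open>s \<le> t\<close> by auto
      qed
      from this[of t] this[of 0] t show ?thesis
        unfolding \<phi>_def
        by (auto intro!: derivative_eq_intros simp: inner_diff_left algebra_simps)
    qed
    obtain s where s: "s \<in> {0<..<t}"
      "\<phi> t - \<phi> 0 = (t - 0) * ((G (x + s *\<^sub>R a + t *\<^sub>R b) - G (x + s *\<^sub>R a + 0 *\<^sub>R b)) \<bullet> a)"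
      using mvt_simple[OF t(1), of \<phi>, OF der] by auto
    define E where "E = G (x + s *\<^sub>R a + t *\<^sub>R b) - G (x + s *\<^sub>R a) - t *\<^sub>R D b"
    have E1: "norm (G (x + s *\<^sub>R a + s' *\<^sub>R b) - G x - D (s *\<^sub>R a + s' *\<^sub>R b)) \<le> e' * (t * N)"
      if "s' \<in> {0..t}" for s'
    proof -
      have n: "norm (s *\<^sub>R a + s' *\<^sub>R b) \<le> t * N"
        using that s by (intro nb) auto
      then have "norm (G (x + s *\<^sub>R a + s' *\<^sub>R b) - G x - D (s *\<^sub>R a + s' *\<^sub>R b)) \<le> e' * norm (s *\<^sub>R a + s' *\<^sub>R b)"
        using d(2)[of "x + s *\<^sub>R a + s' *\<^sub>R b"] tN by (simp add: algebra_simps)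
      also have "\<dots> \<le> e' * (t * N)" using n e' by (intro mult_left_mono) auto
      finally show ?thesis .
    qed
    have "E = (G (x + s *\<^sub>R a + t *\<^sub>R b) - G x - D (s *\<^sub>R a + t *\<^sub>R b))
        - (G (x + s *\<^sub>R a + 0 *\<^sub>R b) - G x - D (s *\<^sub>R a + 0 *\<^sub>R b))"
      by (simp add: E_def D.add D.scaleR)
    then have "norm E \<le> e' * (t * N) + e' * (t * N)"
      using E1[of t] E1[of 0] t norm_triangle_ineq4 order_trans add_mono
      by (smt (verit, best) atLeastAtMost_iff)
    then have En: "norm E \<le> 2 * e' * t * N" by (simp add: algebra_simps)
    have "f (x + t *\<^sub>R a + t *\<^sub>R b) - f (x + t *\<^sub>R a) - f (x + t *\<^sub>R b) + f x = \<phi> t - \<phi> 0"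
      by (simp add: \<phi>_def)
    also have "\<dots> = t * ((E + t *\<^sub>R D b) \<bullet> a)"
      using s(2) by (simp add: E_def)
    also have "\<dots> / t\<^sup>2 = (E \<bullet> a) / t + a \<bullet> D b"
      using t by (simp add: inner_add_left inner_commute[of a] field_simps power2_eq_square)
    finally have "dist ((f (x + t *\<^sub>R a + t *\<^sub>R b) - f (x + t *\<^sub>R a) - f (x + t *\<^sub>R b) + f x) / t\<^sup>2) (a \<bullet> D b)
        = \<bar>E \<bullet> a\<bar> / t"
      using t by (simp add: dist_real_def)
    also have "\<dots> \<le> (2 * e' * t * N) * N / t"
    proof -
      have "\<bar>E \<bullet> a\<bar> \<le> norm E * norm a" by (rule Cauchy_Schwarz_ineq2)
      also have "\<dots> \<le> (2 * e' * t * N) * N"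
        using En N e' t by (intro mult_mono) auto
      finally show ?thesis using t by (intro divide_right_mono) auto
    qed
    also have "\<dots> = e / 2" using t N by (simp add: e'_def)
    also have "\<dots> < e" using \<open>e > 0\<close> by simp
    finally show ?thesis .
  qed
  then show "\<forall>\<^sub>F t in at_right 0. dist ((f (x + t *\<^sub>R a + t *\<^sub>R b) - f (x + t *\<^sub>R a) - f (x + t *\<^sub>R b) + f x) / t\<^sup>2) (a \<bullet> D b) < e"
    using \<open>\<delta> > 0\<close> unfolding eventually_at_right_field by blast
qed

text \<open>Exchanging \<open>a\<close> and \<open>b\<close> leaves the second difference unchanged,
  and limits are unique.\<close>

lemma second_derivative_symmetric:
  fixes f :: "'a::real_inner \<Rightarrow> real" and G :: "'a \<Rightarrow> 'a"
  assumes "open S" "x \<in> S"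
    and "\<And>y. y \<in> S \<Longrightarrow> (f has_derivative (\<lambda>h. G y \<bullet> h)) (at y)"
    and "(G has_derivative D) (at x)"
  shows "a \<bullet> D b = b \<bullet> D a"
proof (rule tendsto_unique[OF _ second_difference_tendsto[OF assms]])
  show "((\<lambda>t. (f (x + t *\<^sub>R a + t *\<^sub>R b) - f (x + t *\<^sub>R a) - f (x + t *\<^sub>R b) + f x) / t\<^sup>2)
            \<longlongrightarrow> b \<bullet> D a) (at_right 0)"
    using second_difference_tendsto[OF assms, of b a] by (simp add: algebra_simps)
qed simp

text \<open>The parabola is the second-order jet of the integral curve of \<open>p\<close>; it replaces that
  curve, so that no existence theorem for ordinary differential equations is needed.\<close>

lemma first_integral_along_jet:
  fixes v :: "'a::real_inner \<Rightarrow> real" and g p :: "'a \<Rightarrow> 'a"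
  assumes "open S" "y \<in> S"
    and v: "\<And>x. x \<in> S \<Longrightarrow> (v has_derivative (\<lambda>h. g x \<bullet> h)) (at x)"
    and g: "isCont g y"
    and gp: "\<And>x. x \<in> S \<Longrightarrow> g x \<bullet> p x = 0"
    and p: "(p has_derivative P) (at y)"
  shows "((\<lambda>t. (v (y + t *\<^sub>R p y + (t\<^sup>2 / 2) *\<^sub>R P (p y)) - v y) / t\<^sup>2) \<longlongrightarrow> 0) (at_right 0)"
proof -
  define q where "q = P (p y)"
  define c where "c = (\<lambda>t::real. y + t *\<^sub>R p y + (t\<^sup>2 / 2) *\<^sub>R q)"
  interpret P: bounded_linear P using p by (rule has_derivative_bounded_linear)
  have c0: "c 0 = y" by (simp add: c_def)
  have dc: "(c has_derivative (\<lambda>h. h *\<^sub>R (p y + t *\<^sub>R q))) (at t within T)" for t T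
    unfolding c_def by (auto intro!: derivative_eq_intros simp: algebra_simps)
  have cc: "isCont c t" for t using dc has_derivative_continuous by blast
  \<comment> \<open>The velocity of \<open>c\<close> at \<open>t\<close> is
    \<open>p y + t *\<^sub>R q\<close>, which differs from \<open>p (c t)\<close> by o(t). Since
    \<open>g\<close> is orthogonal to \<open>p\<close>, the derivative of \<open>v\<close> along
    \<open>c\<close> at \<open>t\<close> is therefore \<open>t * w t\<close>, and \<open>w\<close>
    tends to 0.\<close>
  define w where "w = (\<lambda>t. g (c t) \<bullet> ((1 / t) *\<^sub>R (p y + t *\<^sub>R q - p (c t))))"
  have "((\<lambda>t. p (c t)) has_derivative (\<lambda>h. P (h *\<^sub>R p y))) (at 0)"
    using has_derivative_compose[of c "\<lambda>h. h *\<^sub>R p y" 0 UNIV p P] dc[of 0] p by (simp add: c0)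
  then have "((\<lambda>t. p (c t)) has_vector_derivative q) (at 0)"
    by (simp add: has_vector_derivative_def P.scaleR q_def)
  then have lim: "((\<lambda>t. norm (p (c t) - p y - t *\<^sub>R q) / norm t) \<longlongrightarrow> 0) (at 0)"
    by (simp add: has_vector_derivative_def has_derivative_iff_norm[of _ "\<lambda>h. h *\<^sub>R q"] c0)
  have eq: "norm (p (c t) - p y - t *\<^sub>R q) / norm t = norm ((1 / t) *\<^sub>R (p (c t) - p y) - q)"
    if "t \<noteq> 0" for t
  proof -
    have "(1 / t) *\<^sub>R (p (c t) - p y) - q = (1 / t) *\<^sub>R (p (c t) - p y - t *\<^sub>R q)"
      using that by (simp add: algebra_simps)
    then show ?thesis by simp
  qed
  have "((\<lambda>t. norm ((1 / t) *\<^sub>R (p (c t) - p y) - q)) \<longlongrightarrow> 0) (at 0)"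
  proof (rule Lim_transform_eventually[OF lim])
    have "\<forall>\<^sub>F t in at 0. t \<noteq> (0::real)"
      by (simp add: eventually_at_filter)
    then show "\<forall>\<^sub>F t in at 0. norm (p (c t) - p y - t *\<^sub>R q) / norm t = norm ((1 / t) *\<^sub>R (p (c t) - p y) - q)"
      by (rule eventually_mono) (rule eq)
  qed
  then have "((\<lambda>t. (1 / t) *\<^sub>R (p (c t) - p y)) \<longlongrightarrow> q) (at 0)"
    using Lim_null tendsto_norm_zero_iff by blast
  then have "((\<lambda>t. q - (1 / t) *\<^sub>R (p (c t) - p y)) \<longlongrightarrow> q - q) (at 0)"
    by (intro tendsto_intros)
  moreover have "\<forall>\<^sub>F t in at 0. q - (1 / t) *\<^sub>R (p (c t) - p y) = (1 / t) *\<^sub>R (p y + t *\<^sub>R q - p (c t))"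
    by (auto simp: eventually_at_filter algebra_simps)
  ultimately have "((\<lambda>t. (1 / t) *\<^sub>R (p y + t *\<^sub>R q - p (c t))) \<longlongrightarrow> 0) (at 0)"
    using tendsto_cong by force
  moreover have "((\<lambda>t. g (c t)) \<longlongrightarrow> g y) (at 0)"
    using isCont_tendsto_compose[of y g c "at 0"] cc[of 0] g by (simp add: isCont_def c0)
  ultimately have w0: "(w \<longlongrightarrow> g y \<bullet> 0) (at 0)"
    unfolding w_def by (intro tendsto_intros)
  have "(c \<longlongrightarrow> y) (at 0)"
    using cc[of 0] by (simp add: isCont_def c0)
  then have "\<forall>\<^sub>F t in at 0. c t \<in> S"
    using assms(1,2) by (rule topological_tendstoD)
  then obtain d0 where d0: "d0 > 0" "\<And>t. t \<noteq> 0 \<Longrightarrow> \<bar>t\<bar> < d0 \<Longrightarrow> c t \<in> S"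
    by (auto simp: eventually_at dist_real_def)
  \<comment> \<open>The filter \<open>at 0\<close> leaves out t = 0, whereas the mean value theorem
    is applied on a closed interval starting at 0.\<close>
  have cS: "c t \<in> S" if "\<bar>t\<bar> < d0" for t
    using d0(2)[of t] c0 assms(2) that by (cases "t = 0") auto
  show ?thesis
  proof (rule tendstoI)
    fix e :: real assume "e > 0"
    then have "\<forall>\<^sub>F t in at 0. dist (w t) 0 < e"
      using w0 tendstoD by fastforce
    then obtain d1 where d1: "d1 > 0" "\<And>t. t \<noteq> 0 \<Longrightarrow> \<bar>t\<bar> < d1 \<Longrightarrow> \<bar>w t\<bar> < e"
      by (auto simp: eventually_at dist_real_def)
    have "dist ((v (c t) - v y) / t\<^sup>2) 0 < e" if t: "0 < t" "t < min d0 d1" for t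
    proof -
      have "((\<lambda>t. v (c t)) has_derivative (\<lambda>h. g (c s) \<bullet> (h *\<^sub>R (p y + s *\<^sub>R q)))) (at s within {0..t})"
        if "0 \<le> s" "s \<le> t" for s
        by (rule has_derivative_compose[OF dc v[OF cS]]) (use that t in auto)
      from mvt_simple[OF t(1), of "\<lambda>t. v (c t)", OF this]
      obtain s where s: "s \<in> {0<..<t}"
        "v (c t) - v (c 0) = g (c s) \<bullet> ((t - 0) *\<^sub>R (p y + s *\<^sub>R q))" by blast
      have "g (c s) \<bullet> p (c s) = 0" using s t by (intro gp cS) auto
      then have "g (c s) \<bullet> (p y + s *\<^sub>R q) = s * w s"
        using s by (simp add: w_def inner_diff_right)
      then have "(v (c t) - v y) / t\<^sup>2 = (s / t) * w s"
        using s t by (simp add: c0 power2_eq_square)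
      moreover have "\<bar>(s / t) * w s\<bar> \<le> 1 * \<bar>w s\<bar>"
        unfolding abs_mult using s t by (intro mult_right_mono) auto
      moreover have "\<bar>w s\<bar> < e" using d1(2)[of s] s t by auto
      ultimately show ?thesis by simp
    qed
    moreover have "min d0 d1 > 0" using d0 d1 by simp
    ultimately show "\<forall>\<^sub>F t in at_right 0.
        dist ((v (y + t *\<^sub>R p y + (t\<^sup>2 / 2) *\<^sub>R P (p y)) - v y) / t\<^sup>2) 0 < e"
      unfolding eventually_at_right_field c_def q_def by blast
  qed
qed

section \<open>The inverse-square barrier along a first integral\<close>

text \<open>Along the parabolic jet \<open>v\<close> changes only by o(t^2). By \<open>orth\<close>
  the squared distance to \<open>x0\<close> has no linear term, and by \<open>neg\<close> its
  quadratic term is negative, so the difference of \<open>v\<close> and the barrier drops by a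
  positive multiple of t^2, up to o(t^2).\<close>

lemma inverse_square_barrier_no_local_min:
  fixes v :: "'a::real_inner \<Rightarrow> real" and g p :: "'a \<Rightarrow> 'a"
  assumes "open S" "y \<in> S"
    and v: "\<And>x. x \<in> S \<Longrightarrow> (v has_derivative (\<lambda>h. g x \<bullet> h)) (at x)"
    and g: "isCont g y"
    and gp: "\<And>x. x \<in> S \<Longrightarrow> g x \<bullet> p x = 0"
    and p: "(p has_derivative P) (at y)"
    and "c > 0" "y \<noteq> x0"
    and orth: "(y - x0) \<bullet> p y = 0"
    and neg: "(y - x0) \<bullet> P (p y) + p y \<bullet> p y < 0"
    and min: "\<And>x. x \<in> S \<Longrightarrow> v y - c / (norm (y - x0))\<^sup>2 \<le> v x - c / (norm (x - x0))\<^sup>2"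
  shows False
proof -
  define d where "d = y - x0"
  define q where "q = P (p y)"
  define k where "k = (\<lambda>t::real. y + t *\<^sub>R p y + (t\<^sup>2 / 2) *\<^sub>R q)"
  \<comment> \<open>Half the second derivative at 0 of the squared distance
    \<open>s\<close>.\<close>
  define b where "b = d \<bullet> q + p y \<bullet> p y"
  have b: "b < 0" using neg by (simp add: b_def d_def q_def)
  define s where "s = (\<lambda>t. (norm (k t - x0))\<^sup>2)"
  have d0: "d \<bullet> d > 0" using \<open>y \<noteq> x0\<close> by (simp add: d_def)
  have s0: "(norm (y - x0))\<^sup>2 = d \<bullet> d" by (simp add: d_def power2_norm_eq_inner)
  have s: "s t = d \<bullet> d + t\<^sup>2 * (b + t * (p y \<bullet> q) + t\<^sup>2 / 4 * (q \<bullet> q))" for t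
  proof -
    have "k t - x0 = d + t *\<^sub>R p y + (t\<^sup>2 / 2) *\<^sub>R q" by (simp add: k_def d_def)
    moreover have "d \<bullet> p y = 0" using orth by (simp add: d_def)
    ultimately show ?thesis
      unfolding s_def power2_norm_eq_inner b_def
      by (simp add: inner_add_left inner_add_right inner_commute algebra_simps power2_eq_square)
  qed
  have sl: "(s \<longlongrightarrow> d \<bullet> d) (at_right 0)"
    unfolding s by (auto intro!: tendsto_eq_intros)
  \<comment> \<open>For small t > 0 this is the increment of the difference from \<open>y\<close> to
    \<open>k t\<close>, divided by t^2. The two fractions of the barrier are put over a common
    denominator, so that the factor t^2 of \<open>s t - d \<bullet> d\<close> cancels.\<close>
  have lim: "((\<lambda>t. (v (k t) - v y) / t\<^sup>2 + c * ((b + t * (p y \<bullet> q) + t\<^sup>2 / 4 * (q \<bullet> q)) / (s t * (d \<bullet> d))))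
      \<longlongrightarrow> 0 + c * ((b + 0 * (p y \<bullet> q) + 0\<^sup>2 / 4 * (q \<bullet> q)) / ((d \<bullet> d) * (d \<bullet> d)))) (at_right 0)"
  proof (intro tendsto_add tendsto_mult tendsto_divide tendsto_const tendsto_power tendsto_ident_at sl)
    show "((\<lambda>t. (v (k t) - v y) / t\<^sup>2) \<longlongrightarrow> 0) (at_right 0)"
      using first_integral_along_jet[OF assms(1-6)] by (simp only: k_def q_def)
  qed (use d0 in simp_all)
  have ev: "\<forall>\<^sub>F t in at_right 0. 0 \<le> (v (k t) - v y) / t\<^sup>2 +
      c * ((b + t * (p y \<bullet> q) + t\<^sup>2 / 4 * (q \<bullet> q)) / (s t * (d \<bullet> d)))"
  proof -
    have "(k \<longlongrightarrow> y) (at_right 0)"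
      unfolding k_def by (auto intro!: tendsto_eq_intros)
    then have "\<forall>\<^sub>F t in at_right 0. k t \<in> S"
      using assms(1,2) by (rule topological_tendstoD)
    moreover have "\<forall>\<^sub>F t in at_right 0. s t > 0"
      using order_tendstoD(1)[OF sl d0] .
    moreover have "\<forall>\<^sub>F t in at_right 0. t > (0::real)"
      by (simp add: eventually_at_right_less)
    ultimately show ?thesis
    proof eventually_elim
      case (elim t)
      have "v (k t) - v y \<ge> c / s t - c / (d \<bullet> d)"
        using min[OF elim(1)] by (simp add: s_def s0)
      moreover have "c / s t - c / (d \<bullet> d) = - (t\<^sup>2 * (c * ((b + t * (p y \<bullet> q) + t\<^sup>2 / 4 * (q \<bullet> q)) / (s t * (d \<bullet> d)))))"
      proof -
        have "c / s t - c / (d \<bullet> d) = - (c * (s t - d \<bullet> d) / (s t * (d \<bullet> d)))"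
          using elim d0 by (simp add: field_simps)
        then show ?thesis by (simp add: s[of t])
      qed
      ultimately have "0 \<le> (v (k t) - v y) + t\<^sup>2 * (c * ((b + t * (p y \<bullet> q) + t\<^sup>2 / 4 * (q \<bullet> q)) / (s t * (d \<bullet> d))))"
        by linarith
      then have "0 \<le> ((v (k t) - v y) + t\<^sup>2 * (c * ((b + t * (p y \<bullet> q) + t\<^sup>2 / 4 * (q \<bullet> q)) / (s t * (d \<bullet> d))))) / t\<^sup>2"
        by simp
      then show ?case using elim by (simp add: add_divide_distrib)
    qed
  qed
  have "0 \<le> c * (b / ((d \<bullet> d) * (d \<bullet> d)))"
    using tendsto_lowerbound[OF lim ev] by simp
  moreover have "c * (b / ((d \<bullet> d) * (d \<bullet> d))) < 0"
    using b d0 \<open>c > 0\<close> by (simp add: mult_pos_neg divide_neg_pos)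
  ultimately show False by linarith
qed

section \<open>Orthogonal projection and the tangential part of the system\<close>

text \<open>Needed because \<open>Du_perp\<close> is given through \<open>matrix\<close>, which
  represents a map only if it is linear. Uniqueness of the projection yields linearity.\<close>

lemma linear_orth_proj:
  fixes S :: "'a::euclidean_space set"
  assumes "subspace S"
  shows "linear (orth_proj S)"
proof -
  have *: "orth_proj S v \<in> S \<and> (\<forall>s\<in>S. orthogonal (v - orth_proj S v) s)" for v
    unfolding orth_proj_def by (rule theI'[OF orth_proj_ex1[OF assms]])
  have u: "orth_proj S v = q" if "q \<in> S \<and> (\<forall>s\<in>S. orthogonal (v - q) s)" for v q
    unfolding orth_proj_def by (rule the1_equality[OF orth_proj_ex1[OF assms] that])
  show ?thesis
  proof (rule linearI)
    fix x y
    show "orth_proj S (x + y) = orth_proj S x + orth_proj S y"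
      using *[of x] *[of y] assms
      by (intro u) (auto simp: subspace_add orthogonal_def inner_diff_left inner_add_left)
    fix r
    show "orth_proj S (r *\<^sub>R x) = r *\<^sub>R orth_proj S x"
      using *[of x] assms
      by (intro u) (auto simp: subspace_scale orthogonal_def inner_diff_left)
  qed
qed

lemma transpose_Du_perp_eq_0: "transpose (Du u x) *v (Du_perp u x *v w) = 0"
proof -
  define S where "S = {\<xi>. transpose (Du u x) *v \<xi> = 0}"
  have S: "subspace S"
    unfolding S_def by (auto simp: subspace_def matrix_vector_right_distrib matrix_vector_mult_scaleR
        simp del: transpose_matrix_vector)
  have "Du_perp u x *v w = orth_proj S w"
    unfolding Du_perp_def S_def[symmetric] using linear_orth_proj[OF S]
    by (intro matrix_works) (simp add: linear_matrix_vector_mul_eq)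
  moreover have "orth_proj S w \<in> S"
    using theI'[OF orth_proj_ex1[OF S, of w]] by (simp add: orth_proj_def)
  ultimately show ?thesis by (simp add: S_def)
qed

text \<open>Half the gradient of \<open>norm (Du u x)\<^sup>2\<close>.\<close>

definition energy_grad :: "(real^'n \<Rightarrow> real^'N) \<Rightarrow> real^'n \<Rightarrow> real^'n" where
  "energy_grad u x = (\<Sum>\<beta>\<in>UNIV. Du u x $ \<beta> v* D2 u x \<beta>)"

text \<open>The system reads a + |Du|^2 z = 0 with \<open>a\<close> in the range of
  \<open>Du u x\<close> and \<open>z\<close> in the kernel of its transpose. These spaces are
  orthogonal, so pairing with \<open>a\<close> leaves a \<bullet> a = 0.\<close>

lemma infinity_harmonic_tangential:
  assumes "infinity_harmonic_on \<Omega> u" "x \<in> \<Omega>"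
  shows "Du u x *v energy_grad u x = 0"
proof -
  define w :: "real^'b" where "w = (\<chi> \<beta>. \<Sum>i\<in>UNIV. D2 u x \<beta> $ i $ i)"
  define z where "z = Du_perp u x *v w"
  define a where "a = Du u x *v energy_grad u x"
  have e: "energy_grad u x $ i = (\<Sum>j\<in>UNIV. \<Sum>\<beta>\<in>UNIV. Du u x $ \<beta> $ j * D2 u x \<beta> $ j $ i)" for i
    unfolding energy_grad_def by (subst sum.swap) (simp add: vector_matrix_mult_def mult.commute)
  have "a $ \<alpha> + (norm (Du u x))\<^sup>2 * z $ \<alpha> = 0" for \<alpha>
  proof -
    have "a $ \<alpha> = (\<Sum>i\<in>UNIV. \<Sum>j\<in>UNIV. \<Sum>\<beta>\<in>UNIV. Du u x $ \<alpha> $ i * Du u x $ \<beta> $ j * D2 u x \<beta> $ j $ i)"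
      by (simp add: a_def matrix_vector_mult_def e sum_distrib_left mult.assoc)
    moreover have "z $ \<alpha> = (\<Sum>\<beta>\<in>UNIV. \<Sum>i\<in>UNIV. Du_perp u x $ \<alpha> $ \<beta> * D2 u x \<beta> $ i $ i)"
      by (simp add: z_def w_def matrix_vector_mult_def sum_distrib_left)
    ultimately show ?thesis using assms unfolding infinity_harmonic_on_def by simp
  qed
  then have "a + (norm (Du u x))\<^sup>2 *\<^sub>R z = 0"
    by (simp add: vec_eq_iff)
  moreover have "a \<bullet> z = 0"
  proof -
    have "z \<bullet> a = (z v* Du u x) \<bullet> energy_grad u x"
      unfolding a_def by (rule dot_lmul_matrix[symmetric])
    also have "z v* Du u x = transpose (Du u x) *v z"
      by simp
    also have "\<dots> = 0"
      unfolding z_def by (rule transpose_Du_perp_eq_0)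
    finally show ?thesis by (simp add: inner_commute)
  qed
  moreover have "a \<bullet> (a + (norm (Du u x))\<^sup>2 *\<^sub>R z) = a \<bullet> a + (norm (Du u x))\<^sup>2 * (a \<bullet> z)"
    by (simp add: inner_add_right)
  ultimately have "a \<bullet> a = 0" by simp
  then show ?thesis by (simp add: a_def)
qed

section \<open>Derivatives of C2 maps and of the energy |Du|^2\<close>

lemma C2_on_has_derivative:
  assumes "C2_on \<Omega> u" "x \<in> \<Omega>"
  shows "((\<lambda>y. u y $ \<beta>) has_derivative (\<lambda>h. Du u x $ \<beta> \<bullet> h)) (at x)"
    and "((\<lambda>y. Du u y $ \<beta>) has_derivative (\<lambda>h. D2 u x \<beta> *v h)) (at x)"
proof -
  have "(u has_derivative (\<lambda>h. Du u x *v h)) (at x)"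
    using assms unfolding C2_on_def jacobian_works[symmetric] by blast
  from bounded_linear.has_derivative[OF bounded_linear_vec_nth this]
  show "((\<lambda>y. u y $ \<beta>) has_derivative (\<lambda>h. Du u x $ \<beta> \<bullet> h)) (at x)"
    by (simp add: matrix_vector_mul_component)
  show "((\<lambda>y. Du u y $ \<beta>) has_derivative (\<lambda>h. D2 u x \<beta> *v h)) (at x)"
    using assms unfolding C2_on_def D2_def jacobian_works[symmetric] by blast
qed

lemma D2_symmetric:
  assumes "open \<Omega>" "C2_on \<Omega> u" "x \<in> \<Omega>"
  shows "a \<bullet> (D2 u x \<beta> *v b) = b \<bullet> (D2 u x \<beta> *v a)"
  by (rule second_derivative_symmetric[OF assms(1,3) C2_on_has_derivative(1)[OF assms(2)]
        C2_on_has_derivative(2)[OF assms(2,3)]])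

lemma inner_energy_grad:
  "energy_grad u x \<bullet> h = (\<Sum>\<beta>\<in>UNIV. Du u x $ \<beta> \<bullet> (D2 u x \<beta> *v h))"
  by (simp add: energy_grad_def inner_sum_left dot_lmul_matrix)

lemma energy_has_derivative:
  assumes "C2_on \<Omega> u" "x \<in> \<Omega>"
  shows "((\<lambda>y. (norm (Du u y))\<^sup>2) has_derivative (\<lambda>h. (2 *\<^sub>R energy_grad u x) \<bullet> h)) (at x)"
proof -
  have "((\<lambda>y. \<Sum>\<beta>\<in>UNIV. Du u y $ \<beta> \<bullet> Du u y $ \<beta>) has_derivative
      (\<lambda>h. \<Sum>\<beta>\<in>UNIV. Du u x $ \<beta> \<bullet> (D2 u x \<beta> *v h) + (D2 u x \<beta> *v h) \<bullet> Du u x $ \<beta>)) (at x)"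
    by (intro derivative_intros C2_on_has_derivative[OF assms])
  moreover have "(2 *\<^sub>R energy_grad u x) \<bullet> h
      = (\<Sum>\<beta>\<in>UNIV. Du u x $ \<beta> \<bullet> (D2 u x \<beta> *v h) + (D2 u x \<beta> *v h) \<bullet> Du u x $ \<beta>)" for h
    unfolding inner_scaleR_left inner_energy_grad by (simp add: inner_commute sum_distrib_left)
  \<comment> \<open>The type annotation unfolds only the outer inner product, so the rows of the
    matrix stay vectors.\<close>
  ultimately show ?thesis
    by (simp add: power2_norm_eq_inner inner_vec_def[of "_::real^'a^'b"])
qed

lemma continuous_on_energy_grad:
  assumes "C2_on \<Omega> u"
  shows "continuous_on \<Omega> (energy_grad u)"
proof -
  have "continuous_on \<Omega> (\<lambda>x. Du u x $ \<beta>)" for \<beta>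
    using C2_on_has_derivative(2)[OF assms] has_derivative_continuous continuous_at_imp_continuous_on
    by blast
  then have "continuous_on \<Omega> (\<lambda>x. Du u x)"
    using continuous_on_vec_lambda[of \<Omega> "\<lambda>\<beta> x. Du u x $ \<beta>"] by simp
  moreover have "continuous_on \<Omega> (\<lambda>x. D2 u x \<beta>)" for \<beta>
    using assms by (simp add: C2_on_def)
  ultimately show ?thesis
    unfolding energy_grad_def[abs_def] vector_matrix_mult_def
    by (intro continuous_intros)
qed

section \<open>The barrier argument in the plane\<close>

text \<open>In the plane the orthogonal complement of \<open>d\<close> is the line spanned by
  \<open>d\<close> rotated by a right angle, a vector as long as \<open>d\<close>. This is where
  dimension two enters; applied to each row, it shows that a matrix annihilating \<open>d\<close>
  has rank at most one.\<close>

lemma rank_one_of_kernel: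
  fixes r d :: "real^2"
  assumes "r \<bullet> d = 0" "d \<noteq> 0"
  shows "r = ((r \<bullet> vector [- d$2, d$1]) / (d \<bullet> d)) *\<^sub>R vector [- d$2, d$1]"
proof -
  define D where "D = d \<bullet> d"
  have D: "D = d$1 * d$1 + d$2 * d$2" "D \<noteq> 0"
    using assms(2) by (simp add: D_def inner_vec_def sum_2) (simp add: D_def assms(2))
  have "r$1 * d$1 + r$2 * d$2 = 0" using assms(1) by (simp add: inner_vec_def sum_2)
  then have *: "r$1 * d$1 = - (r$2 * d$2)" "r$2 * d$2 = - (r$1 * d$1)" by linarith+
  have "r$1 * D = (r$1 * d$1) * d$1 + r$1 * d$2 * d$2"
    unfolding D(1) by (simp add: algebra_simps)
  also have "\<dots> = (r$2 * d$1 - r$1 * d$2) * (- d$2)"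
    unfolding *(1) by (simp add: algebra_simps)
  finally have 1: "r$1 * D = (r$2 * d$1 - r$1 * d$2) * (- d$2)" .
  have "r$2 * D = (r$2 * d$2) * d$2 + r$2 * d$1 * d$1"
    unfolding D(1) by (simp add: algebra_simps)
  also have "\<dots> = (r$2 * d$1 - r$1 * d$2) * d$1"
    unfolding *(2) by (simp add: algebra_simps)
  finally have 2: "r$2 * D = (r$2 * d$1 - r$1 * d$2) * d$1" .
  have e: "r \<bullet> vector [- d$2, d$1] = r$2 * d$1 - r$1 * d$2"
    by (simp add: inner_vec_def sum_2)
  have "r$1 = (r$2 * d$1 - r$1 * d$2) / D * (- d$2)" "r$2 = (r$2 * d$1 - r$1 * d$2) / D * d$1"
    unfolding times_divide_eq_left using 1 2 D(2) by (simp_all only: eq_divide_eq not_False_eq_True if_True)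
  then show ?thesis
    unfolding D_def[symmetric] e by (simp add: vec_eq_iff forall_2)
qed

text \<open>Criticality makes the energy gradient a multiple of \<open>d\<close>, so
  \<open>Du u y\<close> kills \<open>d\<close> and its rows are multiples \<xi> of the rotated
  vector \<open>e\<close>. With X = |\<xi>|^2 the curvature condition of the barrier lemma becomes X
  (X D - c / D) < 0, and as X D is the energy at \<open>y\<close>, this is \<open>less\<close>
  multiplied by X.\<close>

lemma energy_barrier_no_local_min:
  fixes u :: "real^2 \<Rightarrow> real^'N"
  assumes "open \<Omega>" and u: "infinity_harmonic_on \<Omega> u"
    and S: "open S" "S \<subseteq> \<Omega>" "y \<in> S"
    and "c > 0" "y \<noteq> x0"
    and less: "(norm (Du u y))\<^sup>2 < c / (norm (y - x0))\<^sup>2"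
    and min: "\<And>x. x \<in> S \<Longrightarrow>
      (norm (Du u y))\<^sup>2 - c / (norm (y - x0))\<^sup>2 \<le> (norm (Du u x))\<^sup>2 - c / (norm (x - x0))\<^sup>2"
  shows False
proof -
  have C2: "C2_on \<Omega> u" using u by (simp add: infinity_harmonic_on_def)
  have y: "y \<in> \<Omega>" using S by blast
  define d where "d = y - x0"
  define e :: "real^2" where "e = vector [- d$2, d$1]"
  define D where "D = d \<bullet> d"
  have "D > 0" using \<open>y \<noteq> x0\<close> by (simp add: D_def d_def)
  have ee: "e \<bullet> e = D" by (simp add: e_def D_def inner_vec_def sum_2)
  have nD: "(norm (y - x0))\<^sup>2 = D" by (simp add: D_def d_def power2_norm_eq_inner)
  have "((\<lambda>x. c / ((x - x0) \<bullet> (x - x0))) has_derivative (\<lambda>h. - (2 * c / D\<^sup>2) * (d \<bullet> h))) (at y)"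
    using \<open>D > 0\<close> unfolding D_def d_def
    by (auto intro!: derivative_eq_intros simp: inner_commute power2_eq_square)
  then have "((\<lambda>x. (norm (Du u x))\<^sup>2 - c / (norm (x - x0))\<^sup>2) has_derivative
      (\<lambda>h. (2 *\<^sub>R energy_grad u y) \<bullet> h - (- (2 * c / D\<^sup>2) * (d \<bullet> h)))) (at y)"
    unfolding power2_norm_eq_inner[of "_ - _"]
    by (intro has_derivative_diff energy_has_derivative[OF C2 y])
  from differential_zero_maxmin[OF S(3,1) this] min
  have "(\<lambda>h. (2 *\<^sub>R energy_grad u y) \<bullet> h - (- (2 * c / D\<^sup>2) * (d \<bullet> h))) = (\<lambda>h. 0)"
    by blast
  from fun_cong[OF this]
  have *: "2 * (energy_grad u y \<bullet> h) + 2 * (c / D\<^sup>2 * (d \<bullet> h)) = 0" for h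
    by (simp add: mult.assoc)
  have "energy_grad u y \<bullet> h = - (c / D\<^sup>2 * (d \<bullet> h))" for h
    using *[of h] by linarith
  then have g: "energy_grad u y \<bullet> h = (- (c / D\<^sup>2) *\<^sub>R d) \<bullet> h" for h
    by simp
  then have gd: "energy_grad u y = - (c / D\<^sup>2) *\<^sub>R d"
    using vector_eq_rdot[of "energy_grad u y" "- (c / D\<^sup>2) *\<^sub>R d"] by blast
  have tang: "Du u x $ \<beta> \<bullet> energy_grad u x = 0" if "x \<in> S" for x \<beta>
  proof -
    have "(Du u x *v energy_grad u x) $ \<beta> = 0"
      using infinity_harmonic_tangential[OF u] that S by auto
    then show ?thesis by (simp add: matrix_vector_mul_component)
  qed
  have "Du u y $ \<beta> \<bullet> d = 0" for \<beta>
    using tang[OF S(3), of \<beta>] \<open>c > 0\<close> \<open>D > 0\<close> by (simp add: gd)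
  moreover have "d \<noteq> 0" using \<open>y \<noteq> x0\<close> by (simp add: d_def)
  ultimately have "Du u y $ \<beta> = ((Du u y $ \<beta> \<bullet> e) / (d \<bullet> d)) *\<^sub>R e" for \<beta>
    unfolding e_def by (rule rank_one_of_kernel)
  then obtain \<xi> where \<xi>: "\<And>\<beta>. Du u y $ \<beta> = \<xi> \<beta> *\<^sub>R e"
    by (rule that[of "\<lambda>\<beta>. (Du u y $ \<beta> \<bullet> e) / (d \<bullet> d)"])
  define X where "X = (\<Sum>\<beta>\<in>UNIV. \<xi> \<beta> * \<xi> \<beta>)"
  have v: "(norm (Du u y))\<^sup>2 = X * D"
    by (simp add: power2_norm_eq_inner inner_vec_def[of "_::real^2^'N"] \<xi> ee X_def sum_distrib_right mult.assoc)
  have egd: "energy_grad u y \<bullet> d = - (c / D)"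
    using \<open>D > 0\<close> by (simp add: gd D_def[symmetric] power2_eq_square)
  \<comment> \<open>If \<open>Du u y\<close> vanished, so would \<open>energy_grad u y\<close>, but
    its product with \<open>d\<close> is - c / D.\<close>
  have "X \<noteq> 0"
  proof
    assume "X = 0"
    then have "\<xi> \<beta> = 0" for \<beta>
      using sum_nonneg_eq_0_iff[of UNIV "\<lambda>\<beta>. \<xi> \<beta> * \<xi> \<beta>"] by (simp add: X_def)
    then have "energy_grad u y \<bullet> d = 0"
      by (simp add: inner_energy_grad \<xi>)
    with egd \<open>c > 0\<close> \<open>D > 0\<close> show False by simp
  qed
  moreover have "X \<ge> 0" unfolding X_def by (intro sum_nonneg) auto
  ultimately have "X > 0" by simp
  \<comment> \<open>The gradient of the scalar function \<xi> \<bullet> u, with \<xi> frozen at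
    \<open>y\<close>. It combines rows of \<open>Du\<close>, so it is orthogonal to the energy
    gradient on all of \<open>S\<close>, as a first integral requires.\<close>
  define p where "p = (\<lambda>x. \<Sum>\<beta>\<in>UNIV. \<xi> \<beta> *\<^sub>R Du u x $ \<beta>)"
  define P where "P = (\<lambda>h. \<Sum>\<beta>\<in>UNIV. \<xi> \<beta> *\<^sub>R (D2 u y \<beta> *v h))"
  have py: "p y = X *\<^sub>R e"
    by (simp add: p_def \<xi> X_def scaleR_sum_left)
  have "d \<bullet> P (p y) = X * (\<Sum>\<beta>\<in>UNIV. \<xi> \<beta> * (d \<bullet> (D2 u y \<beta> *v e)))"
    by (simp add: P_def py inner_sum_right matrix_vector_mult_scaleR sum_distrib_left mult_ac)
  \<comment> \<open>Symmetry of the second derivatives trades the derivative along \<open>e\<close>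
    for one along \<open>d\<close>, where the energy gradient is known.\<close>
  also have "\<dots> = X * (energy_grad u y \<bullet> d)"
    by (simp add: inner_energy_grad \<xi> D2_symmetric[OF assms(1) C2 y, of d _ e])
  finally have dP: "d \<bullet> P (p y) = - (X * (c / D))"
    by (simp add: egd)
  show False
  proof (rule inverse_square_barrier_no_local_min[OF S(1,3)])
    show "((\<lambda>x. (norm (Du u x))\<^sup>2) has_derivative (\<bullet>) (2 *\<^sub>R energy_grad u x)) (at x)" if "x \<in> S" for x
      using energy_has_derivative[OF C2] that S by blast
    have "isCont (energy_grad u) y"
      using continuous_on_energy_grad[OF C2] y assms(1) by (simp add: continuous_on_eq_continuous_at)
    then show "isCont (\<lambda>x. 2 *\<^sub>R energy_grad u x) y"
      by (intro continuous_intros)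
    show "(2 *\<^sub>R energy_grad u x) \<bullet> p x = 0" if "x \<in> S" for x
      using tang[OF that] by (simp add: p_def inner_sum_right inner_commute)
    show "(p has_derivative P) (at y)"
      unfolding p_def P_def by (intro derivative_intros C2_on_has_derivative[OF C2 y])
    show "(y - x0) \<bullet> p y = 0"
      by (simp add: py d_def[symmetric] e_def inner_vec_def sum_2)
    have "X * (X * D - c / D) < 0"
      using less v nD \<open>X > 0\<close> by (intro mult_pos_neg) auto
    then show "(y - x0) \<bullet> P (p y) + p y \<bullet> p y < 0"
      using dP by (simp add: d_def[symmetric]) (simp add: py ee algebra_simps)
  qed (use assms in auto)
qed

text \<open>A zero \<open>z\<close> of \<open>Du\<close> would force the difference \<open>F\<close>
  to attain its minimum over the annulus \<open>K\<close> in the interior, since \<open>F\<close> is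
  too large on both bounding spheres.\<close>

lemma Du_nonzero_on_ball:
  fixes u :: "real^2 \<Rightarrow> real^'N"
  assumes "open \<Omega>" and u: "infinity_harmonic_on \<Omega> u"
    and R: "cball x0 R \<subseteq> \<Omega>" and "Du u x0 \<noteq> 0" and z: "z \<in> ball x0 R"
  shows "Du u z \<noteq> 0"
proof
  assume "Du u z = 0"
  define v where "v = (\<lambda>x. (norm (Du u x))\<^sup>2)"
  have "R > 0" using z by (metis ball_empty empty_iff not_le)
  have C2: "C2_on \<Omega> u" using u by (simp add: infinity_harmonic_on_def)
  have cont: "continuous_on \<Omega> v"
    unfolding v_def using energy_has_derivative[OF C2] has_derivative_continuous
      continuous_at_imp_continuous_on by blast
  define m where "m = v x0 / 2"
  have "m > 0" using \<open>Du u x0 \<noteq> 0\<close> by (simp add: m_def v_def)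
  have "x0 \<in> \<Omega>" using R \<open>R > 0\<close> by auto
  then have "isCont v x0"
    using cont assms(1) by (simp add: continuous_on_eq_continuous_at)
  then have "\<forall>\<^sub>F x in at x0. m < v x"
    using \<open>m > 0\<close> unfolding isCont_def by (intro order_tendstoD) (auto simp: m_def)
  then obtain \<rho>0 where \<rho>0: "\<rho>0 > 0" "\<And>x. x \<noteq> x0 \<Longrightarrow> dist x x0 < \<rho>0 \<Longrightarrow> m < v x"
    by (auto simp: eventually_at)
  define \<rho> where "\<rho> = min \<rho>0 R / 2"
  have \<rho>: "0 < \<rho>" "\<rho> < R" "\<rho> < \<rho>0" using \<rho>0 \<open>R > 0\<close> by (auto simp: \<rho>_def)
  have vm: "m < v x" if "dist x0 x \<le> \<rho>" for x
    using \<rho>0(2)[of x] that \<rho> \<open>m > 0\<close> by (cases "x = x0") (auto simp: dist_commute m_def)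
  \<comment> \<open>Makes the barrier term equal to \<open>m\<close> on the inner sphere, where the
    energy exceeds \<open>m\<close>.\<close>
  define c where "c = m * \<rho>\<^sup>2"
  have "c > 0" using \<open>m > 0\<close> \<rho> by (simp add: c_def)
  \<comment> \<open>The additive constant c / R^2 is left out, so the level - c / R^2 plays the role
    of zero.\<close>
  define F where "F = (\<lambda>x. v x - c / (norm (x - x0))\<^sup>2)"
  define K where "K = cball x0 R - ball x0 \<rho>"
  have zK: "z \<in> K"
    using z vm[of z] \<open>m > 0\<close> \<open>Du u z = 0\<close> by (force simp: K_def v_def)
  have "continuous_on K F"
    unfolding F_def using \<rho> R
    by (intro continuous_intros continuous_on_subset[OF cont]) (auto simp: K_def)
  moreover have "compact K"
    unfolding K_def by (intro compact_diff compact_cball open_ball)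
  ultimately obtain y where y: "y \<in> K" "\<And>x. x \<in> K \<Longrightarrow> F y \<le> F x"
    using continuous_attains_inf[of K F] zK by blast
  have "c / R\<^sup>2 < c / (norm (z - x0))\<^sup>2"
    using zK z \<rho> \<open>c > 0\<close> by (intro divide_strict_left_mono power_strict_mono mult_pos_pos)
      (auto simp: K_def dist_norm norm_minus_commute)
  then have "F z < - (c / R\<^sup>2)"
    using \<open>Du u z = 0\<close> by (simp add: F_def v_def)
  then have Fy: "F y < - (c / R\<^sup>2)" using y(2)[OF zK] by simp
  have "v y \<ge> 0" by (simp add: v_def)
  \<comment> \<open>On the outer sphere \<open>F\<close> is at least - c / R^2 because the energy is
    nonnegative.\<close>
  have "dist x0 y \<noteq> R"
    using Fy \<open>v y \<ge> 0\<close> by (auto simp: F_def dist_norm norm_minus_commute)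
  moreover have "dist x0 y \<noteq> \<rho>"
  proof
    assume *: "dist x0 y = \<rho>"
    then have "F y = v y - m"
      using \<rho> by (simp add: F_def c_def dist_norm norm_minus_commute)
    then have "F y > 0" using vm[of y] * by simp
    moreover have "- (c / R\<^sup>2) \<le> 0" using \<open>c > 0\<close> by simp
    ultimately show False using Fy by linarith
  qed
  ultimately have yS: "y \<in> ball x0 R - cball x0 \<rho>"
    using y(1) by (auto simp: K_def)
  show False
  proof (rule energy_barrier_no_local_min[OF assms(1) u _ _ yS \<open>c > 0\<close>, of x0])
    show "y \<noteq> x0" using yS \<rho> by auto
    have "c / R\<^sup>2 \<ge> 0" using \<open>c > 0\<close> by simp
    then show "(norm (Du u y))\<^sup>2 < c / (norm (y - x0))\<^sup>2"
      using Fy by (simp add: F_def v_def)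
    show "(norm (Du u y))\<^sup>2 - c / (norm (y - x0))\<^sup>2 \<le> (norm (Du u x))\<^sup>2 - c / (norm (x - x0))\<^sup>2"
      if "x \<in> ball x0 R - cball x0 \<rho>" for x
      using y(2)[of x] that by (auto simp: F_def v_def K_def)
  qed (use R in auto)
qed

section \<open>From balls to the whole domain by connectedness\<close>

theorem corollary1p2:
  fixes \<Omega> :: "(real^2) set" and u :: "real^2 \<Rightarrow> real^'N"
  assumes "open \<Omega>" and "connected \<Omega>"
    and "infinity_harmonic_on \<Omega> u"
  shows "((\<forall>x\<in>\<Omega>. norm (Du u x) > 0) \<or> (\<forall>x\<in>\<Omega>. norm (Du u x) = 0)) \<and>
         (\<not> u constant_on \<Omega> \<longrightarrow> (\<forall>x\<in>\<Omega>. rank (Du u x) > 0))"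
proof -
  have C2: "C2_on \<Omega> u" using assms(3) by (simp add: infinity_harmonic_on_def)
  have nbhd: "\<exists>r>0. \<forall>y\<in>ball x r. y \<in> \<Omega> \<and> (Du u y = 0 \<longleftrightarrow> Du u x = 0)" if x: "x \<in> \<Omega>" for x
  proof -
    obtain r where r: "r > 0" "ball x r \<subseteq> \<Omega>" using assms(1) x openE by blast
    \<comment> \<open>With \<open>y\<close> within r / 4 of \<open>x\<close>, the balls of radius r
      / 2 about \<open>x\<close> and about \<open>y\<close> each contain the other centre and stay
      inside \<open>ball x r\<close>. The ball lemma then applies from either centre, so {Du = 0}
      and its complement are both relatively open.\<close>
    have "y \<in> \<Omega> \<and> (Du u y = 0 \<longleftrightarrow> Du u x = 0)" if y: "y \<in> ball x (r / 4)" for y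
    proof (intro conjI iffI)
      have "cball y (r / 2) \<subseteq> ball x r" "cball x (r / 2) \<subseteq> ball x r"
        using y r(1) unfolding cball_subset_ball_iff by (auto simp: dist_commute)
      then have sub: "cball y (r / 2) \<subseteq> \<Omega>" "cball x (r / 2) \<subseteq> \<Omega>" using r by auto
      show "y \<in> \<Omega>" using sub(1) r(1) by auto
      have xy: "y \<in> ball x (r / 2)" "x \<in> ball y (r / 2)" using y r by (auto simp: dist_commute)
      show "Du u x = 0" if "Du u y = 0"
        using Du_nonzero_on_ball[OF assms(1,3) sub(2) _ xy(1)] that by blast
      show "Du u y = 0" if "Du u x = 0"
        using Du_nonzero_on_ball[OF assms(1,3) sub(1) _ xy(2)] that by blast
    qed
    moreover have "r / 4 > 0" using r(1) by simp
    ultimately show ?thesis by blast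
  qed
  have "(Du u x = 0) = (Du u y = 0)" if "x \<in> \<Omega>" "y \<in> \<Omega>" for x y
  proof (rule connected_local_const[where f="\<lambda>x. Du u x = 0", OF assms(2) that], intro ballI)
    fix a assume "a \<in> \<Omega>"
    from nbhd[OF this] obtain r where r: "r > 0" "\<forall>y\<in>ball a r. y \<in> \<Omega> \<and> (Du u y = 0 \<longleftrightarrow> Du u a = 0)"
      by blast
    from eventually_at_ball[OF r(1)]
    show "\<forall>\<^sub>F b in at a within \<Omega>. (Du u a = 0) = (Du u b = 0)"
      by (rule eventually_mono) (use r(2) in blast)
  qed
  then have "(\<forall>x\<in>\<Omega>. norm (Du u x) > 0) \<or> (\<forall>x\<in>\<Omega>. norm (Du u x) = 0)"
    unfolding zero_less_norm_iff norm_eq_zero by blast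
  \<comment> \<open>Used in contrapositive form: a non-constant map is excluded from the second
    alternative.\<close>
  moreover have "u constant_on \<Omega>" if 0: "\<forall>x\<in>\<Omega>. norm (Du u x) = 0"
  proof -
    have der: "(u has_derivative (\<lambda>h. 0)) (at x)" if "x \<in> \<Omega>" for x
    proof -
      have "(u has_derivative (\<lambda>h. Du u x *v h)) (at x)"
        using C2 that unfolding C2_on_def jacobian_works[symmetric] by blast
      then show ?thesis using 0 that by simp
    qed
    then have "continuous_on \<Omega> u"
      using has_derivative_continuous continuous_at_imp_continuous_on by blast
    with der show ?thesis
      by (intro has_derivative_zero_connected_constant_on[OF assms(2,1), of "{}"])
         (auto intro: has_derivative_at_withinI)
  qed
  moreover have "rank (Du u x) > 0" if "norm (Du u x) > 0" for x
    using rank_eq_0[of "Du u x"] that by (intro gr0I) auto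
  ultimately show ?thesis by blast
qed

end
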